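(* There exists an absolute constant $C>0$ such that for every integer $n$ (large enough that $\log\log n>0$), \[ \left(1-C\left(\frac{\log n}{\log\log n}\right)^{-1/4}\right)n \;\leq\; 2f(n, \{0,1\}) \;\leq\; n - \log n . \]
   Context: A word of length $n$ over an alphabet $\Sigma$ is a sequence $S=s_1s_2\ldots s_n$ with $s_i\in\Sigma$; $\Sigma^n$ denotes the set of all such words. A (scattered) subword of $S$ is a word $s_{i_1}s_{i_2}\ldots s_{i_r}$ with $i_1<i_2<\cdots<i_r$; its support is the index set $\{i_1,\ldots,i_r\}$. Two subwords are disjoint if their supports are disjoint. For a word $S$, $f(S)$ is the largest integer $m$ such that $S$ contains two disjoint subwords which are identical as words and each have length $m$. Finally $f(n,\Sigma)=\min\{f(S): S\in\Sigma^n\}$.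
   Formalization: The upper bound 2f(n,{0,1}) ≤ n − log n (log read as the natural logarithm) is claimed only for n ≠ 3, since at n = 3 it is false: every binary word of length 3 repeats a letter, so 2f(3,{0,1}) = 2 > 3 − log 3. *)

theory Defs
  imports "HOL-Analysis.Analysis"
begin

definition words :: "nat \<Rightarrow> 'a set \<Rightarrow> 'a list set" where
  "words n \<Sigma> = {S. set S \<subseteq> \<Sigma> \<and> length S = n}"

text \<open>The subword of \<open>S\<close> with support \<open>I\<close> is \<open>nths S I\<close>; positions are numbered from 0.\<close>

definition twins :: "'a list \<Rightarrow> nat set \<Rightarrow> nat set \<Rightarrow> bool" where
  "twins S I J \<longleftrightarrow>
     I \<subseteq> {..<length S} \<and> J \<subseteq> {..<length S} \<and> I \<inter> J = {} \<and> nths S I = nths S J"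

definition twin_length :: "'a list \<Rightarrow> nat" where
  "twin_length S = Max {m. \<exists>I J. twins S I J \<and> length (nths S I) = m}"

definition min_twin_length :: "nat \<Rightarrow> 'a set \<Rightarrow> nat" where
  "min_twin_length n \<Sigma> = Min (twin_length ` words n \<Sigma>)"

lemma finite_twin_lengths: "finite {m. \<exists>I J. twins S I J \<and> length (nths S I) = m}"
proof (rule finite_subset)
  show "{m. \<exists>I J. twins S I J \<and> length (nths S I) = m} \<subseteq> {..length S}"
  proof clarsimp
    fix I J assume "twins S I J"
    have "card {i. i < length S \<and> i \<in> I} \<le> card {..<length S}"
      by (rule card_mono) auto
    then show "length (nths S I) \<le> length S" by (simp add: length_nths)
  qed
qed simp

lemma twin_length_ge: "twins S I J \<Longrightarrow> length (nths S I) \<le> twin_length S"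
  unfolding twin_length_def by (rule Max_ge[OF finite_twin_lengths]) blast

lemma twin_length_le: "twin_length S \<le> length S"
proof -
  have ne: "{m. \<exists>I J. twins S I J \<and> length (nths S I) = m} \<noteq> {}"
    unfolding twins_def by blast
  have "twin_length S \<in> {m. \<exists>I J. twins S I J \<and> length (nths S I) = m}"
    unfolding twin_length_def by (rule Max_in[OF finite_twin_lengths ne])
  then obtain I where I: "length (nths S I) = twin_length S" by blast
  have "card {i. i < length S \<and> i \<in> I} \<le> card {..<length S}"
    by (rule card_mono) auto
  then show ?thesis using I by (simp add: length_nths)
qed

text \<open>Two of any three binary letters coincide, so \<open>f(3, {0,1}) \<ge> 1\<close> and the upper bound
  \<open>2 f(n, {0,1}) \<le> n - ln n\<close> fails for \<open>n = 3\<close>, although \<open>ln (ln 3) > 0\<close>.\<close>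

lemma upper_bound_fails_at_3:
  "\<not> 2 * real (min_twin_length 3 {0, 1::nat}) \<le> real 3 - ln (real 3)"
proof -
  have ge1: "1 \<le> twin_length S" if S: "S \<in> words 3 {0, 1::nat}" for S
  proof -
    obtain a b c where abc: "S = [a, b, c]"
      using S unfolding words_def numeral_3_eq_3 length_Suc_conv by blast
    have "a = b \<or> a = c \<or> b = c" using S by (auto simp: words_def abc)
    then consider "a = b" | "a = c" | "b = c" by blast
    then show ?thesis
    proof cases
      case 1
      then have "twins S {0} {1}" by (auto simp: twins_def abc nths_Cons)
      from twin_length_ge[OF this] show ?thesis by (simp add: abc nths_Cons)
    next
      case 2
      then have "twins S {0} {2}" by (auto simp: twins_def abc nths_Cons)
      from twin_length_ge[OF this] show ?thesis by (simp add: abc nths_Cons)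
    next
      case 3
      then have "twins S {1} {2}" by (auto simp: twins_def abc nths_Cons)
      from twin_length_ge[OF this] show ?thesis by (simp add: abc nths_Cons)
    qed
  qed
  have "twin_length ` words 3 {0, 1::nat} \<subseteq> {..3}"
  proof (rule image_subsetI)
    fix S assume "S \<in> words 3 {0, 1::nat}"
    then show "twin_length S \<in> {..3}"
      using twin_length_le[of S] by (simp add: words_def)
  qed
  then have fin: "finite (twin_length ` words 3 {0, 1::nat})"
    by (rule finite_subset) simp
  have "[0, 0, 0] \<in> words 3 {0, 1::nat}" by (simp add: words_def)
  then have "twin_length ` words 3 {0, 1::nat} \<noteq> {}" by blast
  then have "1 \<le> min_twin_length 3 {0, 1::nat}"
    unfolding min_twin_length_def using fin ge1 by (simp add: Min_ge_iff)
  moreover have "ln (3::real) > 1"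
  proof -
    have "exp 1 < (3::real)" using e_less_272 by linarith
    then have "ln (exp 1) < ln (3::real)" by (subst ln_less_cancel_iff) auto
    then show ?thesis by simp
  qed
  ultimately show ?thesis by simp
qed

end

theory Submission
  imports Defs
begin

text \<open>Upper bound: in a word of alternating runs of odd lengths that shrink fast enough, twins
  either treat the two copies alike in each run, and then miss a letter of every run, or they miss
  most of some run. Doubling lengths give at least \<open>ln n\<close> runs, except for
  \<open>n = 3\<close> and \<open>n = 8\<close>.

  Lower bound: cut the word into blocks of length \<open>q\<^sup>j\<close>. Within a group of \<open>q\<close> consecutive blocks,
  let the first copy take the ones of block 1, the zeros of block 2, the ones of block 3, and so on,
  and let the second copy do the same one block later. This misses only the two ends of the group
  and the deviations of the numbers of ones from their average. An energy argument over the scales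
  \<open>j < q\<^sup>2\<close> finds a scale where these deviations are small on average, so that at most a fraction
  \<open>5/q\<close> of the letters is missed.\<close>

section \<open>Pairs of disjoint subwords\<close>

inductive disjoint_subwords :: "'a list \<Rightarrow> 'a list \<Rightarrow> 'a list \<Rightarrow> bool" where
  Nil: "disjoint_subwords [] [] []"
| fst: "disjoint_subwords S A B \<Longrightarrow> disjoint_subwords (s # S) (s # A) B"
| snd: "disjoint_subwords S A B \<Longrightarrow> disjoint_subwords (s # S) A (s # B)"
| skip: "disjoint_subwords S A B \<Longrightarrow> disjoint_subwords (s # S) A B"

lemma disjoint_subwords_sym: "disjoint_subwords S A B \<Longrightarrow> disjoint_subwords S B A"
  by (induction rule: disjoint_subwords.induct) (auto intro: disjoint_subwords.intros)

lemma disjoint_subwords_append: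
  assumes "disjoint_subwords S A B" "disjoint_subwords T A' B'"
  shows "disjoint_subwords (S @ T) (A @ A') (B @ B')"
  using assms by (induction rule: disjoint_subwords.induct) (auto intro: disjoint_subwords.intros)

lemma disjoint_subwords_filter_length:
  "disjoint_subwords S A B \<Longrightarrow>
    length (filter P A) + length (filter P B) \<le> length (filter P S)"
  by (induction rule: disjoint_subwords.induct) auto

lemma disjoint_subwords_replicate_append:
  "disjoint_subwords (replicate a c @ R) A B \<Longrightarrow>
    \<exists>x y A' B'. A = replicate x c @ A' \<and> B = replicate y c @ B' \<and> x + y \<le> a \<and>
      disjoint_subwords R A' B'"
proof (induction a arbitrary: A B)
  case 0
  then show ?case by (intro exI[of _ 0] exI[of _ A] exI[of _ B]) simp
next
  case (Suc a)
  from Suc.prems have "disjoint_subwords (c # (replicate a c @ R)) A B" by simp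
  then show ?case
  proof cases
    case (fst A1)
    from Suc.IH[OF fst(2)] obtain x y A' B' where
      "A1 = replicate x c @ A'" "B = replicate y c @ B'" "x + y \<le> a" "disjoint_subwords R A' B'"
      by blast
    with fst show ?thesis by (intro exI[of _ "Suc x"] exI[of _ y] exI[of _ A'] exI[of _ B']) simp
  next
    case (snd B1)
    from Suc.IH[OF snd(2)] obtain x y A' B' where
      "A = replicate x c @ A'" "B1 = replicate y c @ B'" "x + y \<le> a" "disjoint_subwords R A' B'"
      by blast
    with snd show ?thesis by (intro exI[of _ x] exI[of _ "Suc y"] exI[of _ A'] exI[of _ B']) simp
  next
    case skip
    from Suc.IH[OF skip] show ?thesis using le_SucI by fast
  qed
qed

lemma disjoint_subwords_two_letters:
  assumes "c \<noteq> d"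
  shows "\<lbrakk>k \<le> count_list B c; m \<le> count_list B d\<rbrakk> \<Longrightarrow>
    disjoint_subwords B (replicate k c) (replicate m d)"
proof (induction B arbitrary: k m)
  case Nil
  then show ?case by (simp add: disjoint_subwords.Nil)
next
  case (Cons b B)
  consider "b = c" "k > 0" | "b = d" "m > 0" | "k \<le> count_list B c" "m \<le> count_list B d"
    using Cons.prems by (auto split: if_splits)
  then show ?case
  proof cases
    case 1
    with Cons.IH[of "k - 1" m] Cons.prems \<open>c \<noteq> d\<close>
    show ?thesis by (cases k) (auto intro: disjoint_subwords.fst)
  next
    case 2
    with Cons.IH[of k "m - 1"] Cons.prems \<open>c \<noteq> d\<close>
    show ?thesis by (cases m) (auto intro: disjoint_subwords.snd)
  next
    case 3
    with Cons.IH show ?thesis by (auto intro: disjoint_subwords.skip)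
  qed
qed

lemma disjoint_subwords_nths:
  "I \<inter> J = {} \<Longrightarrow> disjoint_subwords S (nths S I) (nths S J)"
proof (induction S arbitrary: I J)
  case Nil
  then show ?case by (simp add: disjoint_subwords.Nil)
next
  case (Cons s S)
  have "disjoint_subwords S (nths S {j. Suc j \<in> I}) (nths S {j. Suc j \<in> J})"
    using Cons.prems by (intro Cons.IH) auto
  then show ?case
    using Cons.prems by (auto simp: nths_Cons intro: disjoint_subwords.intros)
qed

lemma disjoint_subwords_supports:
  "disjoint_subwords S A B \<Longrightarrow>
    \<exists>I J. I \<subseteq> {..<length S} \<and> J \<subseteq> {..<length S} \<and> I \<inter> J = {} \<and> nths S I = A \<and> nths S J = B"
proof (induction rule: disjoint_subwords.induct)
  case Nil
  then show ?case by (intro exI[of _ "{}"]) simp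
next
  case (fst S A B s)
  then obtain I J where "I \<subseteq> {..<length S}" "J \<subseteq> {..<length S}" "I \<inter> J = {}"
    "nths S I = A" "nths S J = B" by blast
  then show ?case
    by - (rule exI[of _ "insert 0 (Suc ` I)"], rule exI[of _ "Suc ` J"], auto simp: nths_Cons inj_image_mem_iff)
next
  case (snd S A B s)
  then obtain I J where "I \<subseteq> {..<length S}" "J \<subseteq> {..<length S}" "I \<inter> J = {}"
    "nths S I = A" "nths S J = B" by blast
  then show ?case
    by - (rule exI[of _ "Suc ` I"], rule exI[of _ "insert 0 (Suc ` J)"], auto simp: nths_Cons inj_image_mem_iff)
next
  case (skip S A B s)
  then obtain I J where "I \<subseteq> {..<length S}" "J \<subseteq> {..<length S}" "I \<inter> J = {}"
    "nths S I = A" "nths S J = B" by blast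
  then show ?case
    by - (rule exI[of _ "Suc ` I"], rule exI[of _ "Suc ` J"], auto simp: nths_Cons inj_image_mem_iff)
qed

lemma length_le_twin_length:
  assumes "disjoint_subwords S A A"
  shows "length A \<le> twin_length S"
proof -
  obtain I J where "twins S I J" "nths S I = A"
    using disjoint_subwords_supports[OF assms] unfolding twins_def by metis
  with twin_length_ge show ?thesis by blast
qed

lemma twin_length_attained:
  obtains A where "disjoint_subwords S A A" "length A = twin_length S"
proof -
  have "twins S {} {}" by (simp add: twins_def)
  then have "{m. \<exists>I J. twins S I J \<and> length (nths S I) = m} \<noteq> {}" by blast
  from Max_in[OF finite_twin_lengths this] obtain I J
    where "twins S I J" "length (nths S I) = twin_length S"
    unfolding twin_length_def by blast
  then show thesis
    using that[of "nths S I"] disjoint_subwords_nths[of I J S] by (simp add: twins_def)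
qed

lemma twin_length_append: "twin_length S + twin_length T \<le> twin_length (S @ T)"
proof -
  obtain A where A: "disjoint_subwords S A A" "length A = twin_length S"
    using twin_length_attained .
  obtain B where B: "disjoint_subwords T B B" "length B = twin_length T"
    using twin_length_attained .
  show ?thesis
    using length_le_twin_length[OF disjoint_subwords_append[OF A(1) B(1)]] A(2) B(2) by simp
qed

lemma twin_length_concat: "(\<Sum>S\<leftarrow>Ss. twin_length S) \<le> twin_length (concat Ss)"
proof (induction Ss)
  case (Cons S Ss)
  then show ?case using twin_length_append[of S "concat Ss"] by simp
qed simp

lemma finite_words: "finite \<Sigma> \<Longrightarrow> finite (words n \<Sigma>)"
  unfolding words_def by (rule finite_lists_length_eq)

lemma min_twin_length_le: "\<lbrakk>finite \<Sigma>; S \<in> words n \<Sigma>\<rbrakk> \<Longrightarrow> min_twin_length n \<Sigma> \<le> twin_length S"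
  unfolding min_twin_length_def by (simp add: finite_words)

lemma min_twin_length_attained:
  assumes "finite \<Sigma>" "\<Sigma> \<noteq> {}"
  obtains S where "S \<in> words n \<Sigma>" "min_twin_length n \<Sigma> = twin_length S"
proof -
  obtain a where "a \<in> \<Sigma>" using assms by blast
  then have "replicate n a \<in> words n \<Sigma>" by (auto simp: words_def)
  then have "twin_length ` words n \<Sigma> \<noteq> {}" by blast
  from Min_in[OF finite_imageI[OF finite_words[OF assms(1)]] this] that show thesis
    unfolding min_twin_length_def by blast
qed


section \<open>The upper bound\<close>

text \<open>If the two copies take different amounts from the first run, then the copy with the smaller
  share has to continue with letters \<open>c\<close> beyond the second run, which it therefore misses.\<close>

lemma first_run_dichotomy:
  assumes "disjoint_subwords (replicate a c @ replicate b d @ T) A A" and "c \<noteq> d"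
  shows "(\<exists>x A'. A = replicate x c @ A' \<and> 2 * x \<le> a \<and>
            disjoint_subwords (replicate b d @ T) A' A') \<or>
         2 * length A + b \<le> a + b + length T + count_list T d"
proof -
  obtain x y A' B' where A: "A = replicate x c @ A'" "A = replicate y c @ B'" "x + y \<le> a"
    and R: "disjoint_subwords (replicate b d @ T) A' B'"
    using disjoint_subwords_replicate_append[OF assms(1)] by blast
  have unbalanced: "2 * length A + b \<le> a + b + length T + count_list T d"
    if A: "A = replicate x c @ A'" "A = replicate y c @ B'" "y < x"
      and R: "disjoint_subwords (replicate b d @ T) A' B'" for x y A' B'
  proof -
    have "replicate y c @ B' = replicate y c @ replicate (x - y) c @ A'"
      using A by (metis append_assoc le_add_diff_inverse less_imp_le replicate_add)
    then have B': "B' = replicate (x - y) c @ A'" by simp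
    obtain u v A2 B2 where *: "A' = replicate u d @ A2" "B' = replicate v d @ B2"
      "disjoint_subwords T A2 B2"
      using disjoint_subwords_replicate_append[OF R] by blast
    have "v = 0"
    proof (rule ccontr)
      assume "v \<noteq> 0"
      then have "hd B' = d" using * by (cases v) auto
      moreover have "hd B' = c" using B' A(3) by (cases "x - y") auto
      ultimately show False using \<open>c \<noteq> d\<close> by simp
    qed
    then have "length (filter ((=) d) A) = length (filter ((=) d) B2)"
      using A(2) *(2) \<open>c \<noteq> d\<close> by simp
    moreover have "length (filter ((=) d) B2) \<le> count_list T d"
      using disjoint_subwords_filter_length[OF *(3), of "(=) d"]
      by (simp add: count_list_eq_length_filter)
    moreover have "2 * length (filter (\<lambda>z. d \<noteq> z) A) \<le> a + length (filter (\<lambda>z. d \<noteq> z) T)"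
      using disjoint_subwords_filter_length[OF assms(1), of "\<lambda>z. d \<noteq> z"] \<open>c \<noteq> d\<close> by simp
    moreover have "length (filter (\<lambda>z. d \<noteq> z) X) + length (filter ((=) d) X) = length X" for X
      using sum_length_filter_compl[of "(=) d" X] by simp
    from this[of A] this[of T]
    have "length (filter (\<lambda>z. d \<noteq> z) A) + length (filter ((=) d) A) = length A"
      "length (filter (\<lambda>z. d \<noteq> z) T) + count_list T d = length T"
      by (simp_all add: count_list_eq_length_filter)
    ultimately show ?thesis by linarith
  qed
  consider "x = y" | "y < x" | "x < y" by linarith
  then show ?thesis
  proof cases
    case 1
    then have "2 * x \<le> a" "B' = A'" using A by auto
    then show ?thesis using A R by blast
  next
    case 2
    then show ?thesis using unbalanced[OF A(1,2) _ R] by blast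
  next
    case 3
    then show ?thesis using unbalanced[OF A(2,1) _ disjoint_subwords_sym[OF R]] by blast
  qed
qed

text \<open>The run lengths \<open>2\<^sup>k + 1, \<dots>, 5, 3, 1\<close> are odd, and each exceeds the total length of the later
  runs of the same letter by more than the number of all later runs, so unbalanced twins do not pay
  and balanced twins miss a letter of every run.\<close>

fun core :: "nat \<Rightarrow> nat \<Rightarrow> nat list" where
  "core 0 c = [c]"
| "core (Suc k) c = replicate (2 ^ Suc k + 1) c @ core k (1 - c)"

lemma length_core: "length (core k c) + 1 = 2 ^ Suc k + k"
  by (induction k arbitrary: c) auto

lemma set_core: "c \<in> {0, 1} \<Longrightarrow> set (core k c) \<subseteq> {0, 1}"
proof (induction k arbitrary: c)
  case (Suc k)
  have "1 - c \<in> {0, 1}" using Suc.prems by auto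
  from Suc.IH[OF this] Suc.prems show ?case by auto
qed simp

lemma count_core_other:
  "c \<in> {0, 1} \<Longrightarrow> count_list (core k c) (1 - c) + k + 1 \<le> 2 ^ Suc k"
proof (induction k arbitrary: c rule: less_induct)
  case (less k)
  consider "k = 0" | "k = 1" | m where "k = Suc (Suc m)"
    by (metis One_nat_def not0_implies_Suc)
  then show ?case
  proof cases
    case (3 m)
    have "count_list (replicate n a) b = (if a = b then n else 0)" for n and a b :: nat
      by (induction n) auto
    moreover have "1 - (1 - c) = c" "c \<noteq> 1 - c" using less.prems by auto
    ultimately have "count_list (core k c) (1 - c) = 2 ^ Suc m + 1 + count_list (core m c) (1 - c)"
      using less.prems unfolding 3 by simp
    moreover have "count_list (core m c) (1 - c) + m + 1 \<le> 2 ^ Suc m"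
      using less 3 by simp
    moreover have "(2::nat) ^ Suc m \<ge> 2" "(2::nat) ^ Suc k = 4 * 2 ^ Suc m"
      using 3 by simp_all
    ultimately show ?thesis using 3 by linarith
  qed (use less.prems in auto)
qed

lemma twins_in_runs:
  assumes "c \<in> {0, 1}" "odd a" "disjoint_subwords (replicate a c @ core k (1 - c)) A A"
  shows "2 * length A + (k + 2) \<le> a + length (core k (1 - c))"
  using assms
proof (induction k arbitrary: a c A)
  case 0
  have "c \<noteq> 1 - c" using "0.prems" by auto
  have "disjoint_subwords (replicate a c @ replicate 1 (1 - c) @ []) A A"
    using "0.prems" by simp
  from first_run_dichotomy[OF this \<open>c \<noteq> 1 - c\<close>] show ?case
  proof
    assume "\<exists>x A'. A = replicate x c @ A' \<and> 2 * x \<le> a \<and>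
            disjoint_subwords (replicate 1 (1 - c) @ []) A' A'"
    then obtain x A' where A: "A = replicate x c @ A'" "2 * x \<le> a"
      and A': "disjoint_subwords [1 - c] A' A'" by auto
    have "2 * length A' \<le> 1"
      using disjoint_subwords_filter_length[OF A', of "\<lambda>_. True"] by simp
    then have "length A' = 0" by linarith
    moreover have "2 * x \<noteq> a" using \<open>odd a\<close> by auto
    ultimately show ?thesis using A by simp
  next
    assume "2 * length A + 1 \<le> a + 1 + length [] + count_list [] (1 - c)"
    then have "2 * length A \<le> a" by simp
    moreover have "2 * length A \<noteq> a" using \<open>odd a\<close> by auto
    ultimately show ?thesis by simp
  qed
next
  case (Suc k)
  let ?b = "2 ^ Suc k + 1 :: nat"
  have c: "c \<noteq> 1 - c" "1 - (1 - c) = c" "1 - c \<in> {0, 1}" using Suc.prems(1) by auto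
  have core: "core (Suc k) (1 - c) = replicate ?b (1 - c) @ core k c"
    using c(2) by simp
  have "disjoint_subwords (replicate a c @ replicate ?b (1 - c) @ core k c) A A"
    using Suc.prems(3) unfolding core .
  from first_run_dichotomy[OF this c(1)] show ?case
  proof
    assume "\<exists>x A'. A = replicate x c @ A' \<and> 2 * x \<le> a \<and>
            disjoint_subwords (replicate ?b (1 - c) @ core k c) A' A'"
    then obtain x A' where A: "A = replicate x c @ A'" "2 * x \<le> a"
      and A': "disjoint_subwords (replicate ?b (1 - c) @ core k (1 - (1 - c))) A' A'"
      unfolding c(2) by blast
    have "2 * length A' + (k + 2) \<le> ?b + length (core k c)"
      using Suc.IH[OF c(3) _ A'] unfolding c(2) by simp
    moreover have "2 * x \<noteq> a" using \<open>odd a\<close> by auto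
    ultimately show ?thesis using A unfolding core by simp
  next
    assume "2 * length A + ?b \<le> a + ?b + length (core k c) + count_list (core k c) (1 - c)"
    with count_core_other[OF Suc.prems(1), of k]
    have "2 * length A + (k + 2) \<le> a + length (core (Suc k) (1 - c))"
      unfolding core by simp
    moreover have "2 * length A + (k + 2) \<noteq> a + length (core (Suc k) (1 - c))"
    proof
      assume "2 * length A + (k + 2) = a + length (core (Suc k) (1 - c))"
      then have "2 * length A + (k + 2) + 1 = a + 2 ^ Suc (Suc k) + Suc k"
        using length_core[of "Suc k" "1 - c"] by linarith
      then have "a = 2 * (length A + 1 - 2 ^ Suc k)"
        by (simp add: algebra_simps)
      then show False using \<open>odd a\<close> by simp
    qed
    ultimately show ?thesis by linarith
  qed
qed

lemma min_twin_length_runs: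
  assumes "2 ^ Suc k + k \<le> n" "even (n + k)"
  shows "2 * min_twin_length n {0, 1::nat} + (k + 2) \<le> n"
proof -
  define a where "a = n + 1 - (2 ^ Suc k + k)"
  have len: "a + length (core k 1) = n"
    using length_core[of k 1] assms(1) unfolding a_def by linarith
  have "odd a" using assms unfolding a_def by simp
  define S where "S = replicate a 0 @ core k (1 - 0)"
  obtain A where A: "disjoint_subwords S A A" "length A = twin_length S"
    using twin_length_attained .
  have "2 * length A + (k + 2) \<le> n"
    using twins_in_runs[OF _ \<open>odd a\<close> A(1)[unfolded S_def]] len by simp
  moreover have "S \<in> words n {0, 1}"
    using len set_core[of 1 k] by (auto simp: words_def S_def)
  then have "min_twin_length n {0, 1::nat} \<le> twin_length S"
    by (simp add: min_twin_length_le)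
  ultimately show ?thesis using A(2) by linarith
qed

text \<open>Length 8 calls for four missed letters, but the run construction with four runs starts only
  at length 10; the word 01110001 fills the gap.\<close>

lemma min_twin_length_8: "min_twin_length 8 {0, 1::nat} \<le> 2"
proof -
  let ?S = "replicate 1 0 @ replicate 3 1 @ replicate 3 0 @ replicate 1 1 @ [] :: nat list"
  have "?S \<in> words 8 {0, 1}" by (simp add: words_def)
  then have "min_twin_length 8 {0, 1::nat} \<le> twin_length ?S"
    by (simp add: min_twin_length_le del: replicate.simps)
  moreover obtain A where A: "disjoint_subwords ?S A A" "length A = twin_length ?S"
    using twin_length_attained .
  moreover have "length A \<le> 2"
  proof -
    obtain x1 y1 A1 B1 where 1: "A = replicate x1 0 @ A1" "A = replicate y1 0 @ B1" "x1 + y1 \<le> 1"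
      "disjoint_subwords (replicate 3 1 @ replicate 3 0 @ replicate 1 1 @ []) A1 B1"
      using disjoint_subwords_replicate_append[OF A(1)] by blast
    obtain x2 y2 A2 B2 where 2: "A1 = replicate x2 1 @ A2" "B1 = replicate y2 1 @ B2" "x2 + y2 \<le> 3"
      "disjoint_subwords (replicate 3 0 @ replicate 1 1 @ []) A2 B2"
      using disjoint_subwords_replicate_append[OF 1(4)] by blast
    obtain x3 y3 A3 B3 where 3: "A2 = replicate x3 0 @ A3" "B2 = replicate y3 0 @ B3" "x3 + y3 \<le> 3"
      "disjoint_subwords (replicate 1 1 @ []) A3 B3"
      using disjoint_subwords_replicate_append[OF 2(4)] by blast
    obtain x4 y4 A4 B4 where 4: "A3 = replicate x4 1 @ A4" "B3 = replicate y4 1 @ B4" "x4 + y4 \<le> 1"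
      "disjoint_subwords [] A4 B4"
      using disjoint_subwords_replicate_append[OF 3(4)] by blast
    have "A4 = []" "B4 = []" using 4(4) by (auto elim: disjoint_subwords.cases)
    then have eq: "replicate x1 0 @ replicate x2 1 @ replicate x3 0 @ replicate x4 1 =
      replicate y1 0 @ replicate y2 1 @ replicate y3 0 @ replicate y4 (1::nat)"
      and len: "length A = x1 + x2 + x3 + x4"
      using 1(1,2) 2(1,2) 3(1,2) 4(1,2) by auto
    have count_replicate: "count_list (replicate n a) b = (if a = b then n else 0)"
      for n and a b :: nat
      by (induction n) auto
    have zeros: "x1 + x3 = y1 + y3"
      using arg_cong[OF eq, of "\<lambda>X. count_list X 0"] by (simp add: count_replicate)
    have ones: "x2 + x4 = y2 + y4"
      using arg_cong[OF eq, of "\<lambda>X. count_list X 1"] by (simp add: count_replicate)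
    have "y2 = 0" if "x1 = 1" "y1 = 0" using eq that by (cases y2) auto
    moreover have "x2 = 0" if "x1 = 0" "y1 = 1" using eq that by (cases x2) auto
    ultimately consider
        "x1 = 0" "y1 = 0" | "x1 = 1" "y1 = 0" "y2 = 0" | "x1 = 0" "y1 = 1" "x2 = 0"
      using 1(3) by linarith
    then have False if long: "\<not> length A \<le> 2"
    proof cases
      case 1
      then have x3: "x3 = 1" "y3 = 1" "x2 + x4 = 2"
        using zeros ones long len 2(3) 3(3) 4(3) by linarith+
      then have "x2 + y2 = 3" "x4 + y4 = 1"
        using ones 2(3) 4(3) by linarith+
      with x3 consider "x4 = 0" "x2 = 2" "y2 = 1" "y4 = 1" | "x4 = 1" "x2 = 1" "y2 = 2" "y4 = 0"
        by linarith
      then show False using 1 x3 eq by cases (simp_all add: numeral_eq_Suc)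
    next
      case 2
      then have "x3 = 1" "y3 = 2" "y4 = 1" "x4 = 0" "x2 = 1"
        using zeros ones long len 3(3) 4(3) by linarith+
      then show False using 2 eq by (simp add: numeral_eq_Suc)
    next
      case 3
      then have "y3 = 1" "x3 = 2" "x4 = 1" "y4 = 0" "y2 = 1"
        using zeros ones long len \<open>x3 + y3 \<le> 3\<close> 4(3) by linarith+
      then show False using 3 eq by (simp add: numeral_eq_Suc)
    qed
    then show ?thesis by blast
  qed
  ultimately show ?thesis by linarith
qed

lemma exp_1_ge: "(2.6::real) \<le> exp 1"
proof -
  have "(1.625::real) \<le> exp (1/2)"
    using exp_lower_Taylor_quadratic[of "1/2"] by (simp add: power2_eq_square)
  then have "(1.625::real) ^ 2 \<le> exp (1/2) ^ 2" by (rule power_mono) simp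
  also have "\<dots> = exp 1" by (simp flip: exp_of_nat_mult)
  finally show ?thesis by (simp add: power2_eq_square)
qed

lemma two_power_le_exp: "k \<ge> 1 \<Longrightarrow> 2 ^ (k + 3) + real k \<le> exp (real (k + 2))"
proof -
  assume "k \<ge> 1"
  then have "2 ^ (k + 3) + real k \<le> (2.6::real) ^ (k + 2)"
  proof (induction k rule: dec_induct)
    case base
    then show ?case by (simp add: power_def)
  next
    case (step k)
    have "(2::real) ^ (Suc k + 3) = 2 * 2 ^ (k + 3)" "(1::real) \<le> real k" "(0::real) \<le> 2 ^ (k + 3)"
      using step.hyps by (simp_all add: power_add)
    then have "2 ^ (Suc k + 3) + real (Suc k) \<le> 2.6 * (2 ^ (k + 3) + real k)"
      unfolding of_nat_Suc by (simp add: algebra_simps; linarith)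
    also have "\<dots> \<le> (2.6::real) ^ (Suc k + 2)" using step.IH by simp
    finally show ?case .
  qed
  also have "\<dots> \<le> exp 1 ^ (k + 2)" by (rule power_mono[OF exp_1_ge]) simp
  also have "\<dots> = exp (real (k + 2))" using exp_of_nat_mult[of "k + 2" "1::real"] by simp
  finally show ?thesis .
qed

lemma min_twin_length_upper:
  assumes "n \<ge> 4"
  shows "2 * real (min_twin_length n {0, 1::nat}) \<le> real n - ln (real n)"
proof (cases "n = 8")
  case True
  have "8 \<le> exp (4::real)" using exp_lower_Taylor_quadratic[of 4] by (simp add: power2_eq_square)
  then have "ln 8 \<le> ln (exp (4::real))" by (subst ln_le_cancel_iff) auto
  then show ?thesis using True min_twin_length_8 by simp
next
  case False
  define P where "P k \<longleftrightarrow> 2 ^ Suc k + k \<le> n \<and> even (n + k)" for k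
  have "\<exists>k. P k"
  proof (cases "even n")
    case True
    then have "P 0" using assms by (simp add: P_def)
    then show ?thesis ..
  next
    case False
    then have "n \<noteq> 4" by auto
    then have "P 1" using assms False by (simp add: P_def)
    then show ?thesis ..
  qed
  moreover have bound: "k \<le> n" if "P k" for k using that by (simp add: P_def)
  ultimately obtain k where k: "P k" "\<And>l. P l \<Longrightarrow> l \<le> k"
    by (metis GreatestI_ex_nat Greatest_le_nat)
  have "\<not> P (k + 2)" using k(2)[of "k + 2"] by auto
  then have "n < 2 ^ Suc (k + 2) + (k + 2)" using k(1) by (auto simp: P_def)
  moreover have "n \<noteq> 2 ^ Suc (k + 2) + (k + 1)"
  proof
    assume "n = 2 ^ Suc (k + 2) + (k + 1)"
    then have "n + k = 2 * (2 ^ (k + 2) + k) + 1" by simp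
    then show False using k(1) by (simp add: P_def)
  qed
  ultimately have n: "n \<le> 2 ^ (k + 3) + k" by (simp add: numeral_3_eq_3)
  have "real n \<le> exp (real (k + 2))"
  proof (cases "k = 0")
    case True
    then have "n < 8" "even n" using n False k(1) by (auto simp: P_def)
    then have "n \<noteq> 7" by auto
    then have "real n \<le> 2.6 ^ 2" using \<open>n < 8\<close> by (simp add: power2_eq_square)
    also have "\<dots> \<le> exp 1 ^ 2" by (rule power_mono[OF exp_1_ge]) simp
    also have "\<dots> = exp (real (k + 2))" using True by (simp flip: exp_of_nat_mult)
    finally show ?thesis .
  next
    case False
    have "real n \<le> real (2 ^ (k + 3) + k)" using n by (simp only: of_nat_le_iff)
    also have "\<dots> \<le> exp (real (k + 2))" using two_power_le_exp[of k] False by simp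
    finally show ?thesis .
  qed
  then have "ln (real n) \<le> ln (exp (real (k + 2)))"
    using assms by (subst ln_le_cancel_iff) auto
  moreover have "2 * min_twin_length n {0, 1::nat} + (k + 2) \<le> n"
    using k(1) min_twin_length_runs unfolding P_def by blast
  then have "real (2 * min_twin_length n {0, 1::nat} + (k + 2)) \<le> real n"
    by (simp only: of_nat_le_iff)
  ultimately show ?thesis by simp
qed


section \<open>The lower bound\<close>

text \<open>One copy is \<open>c\<^sup>k X\<close>, where \<open>c\<^sup>k\<close> is taken from the first block, and the other copy \<open>Y\<close> avoids
  the first block. Prepending a block exchanges the roles of the two copies and of the two letters:
  the new block and the old first block are matched in the letter not yet used.\<close>

lemma twins_in_block_chain:
  fixes \<mu> :: real
  assumes "c \<in> {0, 1::nat}"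
    and "\<And>B. B \<in> set (B0 # Bs) \<Longrightarrow> set B \<subseteq> {0, 1} \<and> length B = l"
  shows "\<exists>k X Y. k \<le> count_list B0 c \<and> disjoint_subwords (concat Bs) X Y \<and>
    replicate k c @ X = Y \<and>
    real (count_list B0 c) + (real (length Bs) - 1) * l - \<bar>real (count_list B0 1) - \<mu>\<bar>
      - 2 * (\<Sum>B\<leftarrow>Bs. \<bar>real (count_list B 1) - \<mu>\<bar>) \<le> 2 * real (length Y)"
  using assms
proof (induction Bs arbitrary: B0 c)
  case Nil
  have "count_list B0 c \<le> l" using Nil.prems(2)[of B0] count_le_length[of B0 c] by simp
  then show ?case
    by (intro exI[of _ 0] exI[of _ "[]"]) (simp add: disjoint_subwords.Nil)
next
  case (Cons B1 Bs)
  have c: "1 - c \<in> {0, 1}" "1 - c \<noteq> c" using Cons.prems(1) by auto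
  have split: "count_list B 0 + count_list B 1 = length B" if "set B \<subseteq> {0, 1::nat}" for B
    using that by (induction B) auto
  have B0: "count_list B0 0 + count_list B0 1 = l" and B1: "count_list B1 0 + count_list B1 1 = l"
    using Cons.prems(2)[of B0] Cons.prems(2)[of B1] split by auto
  have "set B \<subseteq> {0, 1} \<and> length B = l" if "B \<in> set (B1 # Bs)" for B
    using Cons.prems(2)[of B] that by simp
  from Cons.IH[OF c(1) this] obtain k X Y where k: "k \<le> count_list B1 (1 - c)"
    and XY: "disjoint_subwords (concat Bs) X Y" "replicate k (1 - c) @ X = Y"
    and bound: "real (count_list B1 (1 - c)) + (real (length Bs) - 1) * l
      - \<bar>real (count_list B1 1) - \<mu>\<bar> - 2 * (\<Sum>B\<leftarrow>Bs. \<bar>real (count_list B 1) - \<mu>\<bar>)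
      \<le> 2 * real (length Y)"
    by blast
  define m where "m = min (count_list B0 c) (count_list B1 c)"
  have "disjoint_subwords B1 (replicate k (1 - c)) (replicate m c)"
    using k by (intro disjoint_subwords_two_letters c(2)) (simp_all add: m_def)
  from disjoint_subwords_append[OF this XY(1)]
  have tw: "disjoint_subwords (concat (B1 # Bs)) Y (replicate m c @ Y)"
    using XY(2) by simp
  have "2 * real m = real (count_list B0 c) + real (count_list B1 c)
      - \<bar>real (count_list B0 c) - real (count_list B1 c)\<bar>"
    by (simp add: m_def min_def)
  moreover have "\<bar>real (count_list B0 c) - real (count_list B1 c)\<bar>
      = \<bar>real (count_list B0 1) - real (count_list B1 1)\<bar>"
    using Cons.prems(1) B0 B1 by auto
  moreover have "real (count_list B1 c) + real (count_list B1 (1 - c)) = l"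
    using Cons.prems(1) B1 by auto
  moreover have "(real (length (B1 # Bs)) - 1) * l = l + (real (length Bs) - 1) * l"
    by (simp add: algebra_simps)
  moreover have "(\<Sum>B\<leftarrow>B1 # Bs. \<bar>real (count_list B 1) - \<mu>\<bar>) =
      \<bar>real (count_list B1 1) - \<mu>\<bar> + (\<Sum>B\<leftarrow>Bs. \<bar>real (count_list B 1) - \<mu>\<bar>)"
    "real (length (replicate m c @ Y)) = m + real (length Y)"
    by simp_all
  ultimately have "real (count_list B0 c) + (real (length (B1 # Bs)) - 1) * l
      - \<bar>real (count_list B0 1) - \<mu>\<bar> - 2 * (\<Sum>B\<leftarrow>B1 # Bs. \<bar>real (count_list B 1) - \<mu>\<bar>)
      \<le> 2 * real (length (replicate m c @ Y))"
    using bound by linarith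
  with tw show ?case
    by (intro exI[of _ m] exI[of _ Y] exI[of _ "replicate m c @ Y"]) (simp add: m_def)
qed

lemma twin_length_blocks:
  fixes \<mu> :: real
  assumes "Bs \<noteq> []" and "\<And>B. B \<in> set Bs \<Longrightarrow> set B \<subseteq> {0, 1::nat} \<and> length B = l"
  shows "(real (length Bs) - 2) * l - 2 * (\<Sum>B\<leftarrow>Bs. \<bar>real (count_list B 1) - \<mu>\<bar>)
    \<le> 2 * real (twin_length (concat Bs))"
proof -
  obtain B0 Bs' where Bs: "Bs = B0 # Bs'" using assms(1) by (cases Bs) auto
  obtain k X Y where k: "k \<le> count_list B0 1"
    and XY: "disjoint_subwords (concat Bs') X Y" "replicate k 1 @ X = Y"
    and bound: "real (count_list B0 1) + (real (length Bs') - 1) * l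
      - \<bar>real (count_list B0 1) - \<mu>\<bar> - 2 * (\<Sum>B\<leftarrow>Bs'. \<bar>real (count_list B 1) - \<mu>\<bar>)
      \<le> 2 * real (length Y)"
    using twins_in_block_chain[of 1 B0 Bs' l \<mu>] assms(2) unfolding Bs by blast
  have "disjoint_subwords B0 (replicate k 1) (replicate 0 0)"
    using k by (intro disjoint_subwords_two_letters) auto
  from disjoint_subwords_append[OF this XY(1)] have "disjoint_subwords (concat Bs) Y Y"
    using XY(2) Bs by simp
  from length_le_twin_length[OF this] have "length Y \<le> twin_length (concat Bs)" .
  then have "2 * real (length Y) \<le> 2 * real (twin_length (concat Bs))" by simp
  moreover have "(real (length Bs) - 2) * l = (real (length Bs') - 1) * l"
    "(\<Sum>B\<leftarrow>Bs. \<bar>real (count_list B 1) - \<mu>\<bar>) =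
      \<bar>real (count_list B0 1) - \<mu>\<bar> + (\<Sum>B\<leftarrow>Bs'. \<bar>real (count_list B 1) - \<mu>\<bar>)"
    by (simp_all add: Bs)
  ultimately show ?thesis using bound by linarith
qed

fun block :: "nat \<Rightarrow> 'a list \<Rightarrow> nat \<Rightarrow> nat \<Rightarrow> 'a list" where
  "block q S 0 i = [S ! i]"
| "block q S (Suc j) i = concat (map (block q S j) [i * q..<i * q + q])"

lemma length_block: "length (block q S j i) = q ^ j"
  by (induction j arbitrary: i) (simp_all add: length_concat comp_def sum_list_triv)

lemma set_block:
  assumes "set S \<subseteq> \<Sigma>"
  shows "(i + 1) * q ^ j \<le> length S \<Longrightarrow> set (block q S j i) \<subseteq> \<Sigma>"
proof (induction j arbitrary: i)
  case 0
  then show ?case using assms nth_mem[of i S] by auto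
next
  case (Suc j)
  have "set (block q S j r) \<subseteq> \<Sigma>" if "r \<in> {i * q..<i * q + q}" for r
  proof (rule Suc.IH)
    have "(r + 1) * q ^ j \<le> ((i + 1) * q) * q ^ j"
      using that by (intro mult_right_mono) auto
    also have "\<dots> \<le> length S" using Suc.prems by (simp add: algebra_simps)
    finally show "(r + 1) * q ^ j \<le> length S" .
  qed
  then show ?case by fastforce
qed

lemma concat_map_group:
  "concat (map g [0..<m * q]) = concat (map (\<lambda>p. concat (map g [p * q..<p * q + q])) [0..<m])"
proof (induction m)
  case (Suc m)
  have "[0..<Suc m * q] = [0..<m * q] @ [m * q..<m * q + q]"
    by (metis add.commute mult_Suc upt_add_eq_append zero_le)
  then show ?case using Suc by simp
qed simp

lemma concat_blocks:
  "length S = m * q ^ j \<Longrightarrow> concat (map (block q S j) [0..<m]) = S"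
proof (induction j arbitrary: m)
  case 0
  have "concat (map (\<lambda>i. [S ! i]) [0..<m]) = map ((!) S) [0..<m]"
    by (induction m) auto
  then show ?case using 0 map_nth[of S] by simp
next
  case (Suc j)
  have "concat (map (block q S (Suc j)) [0..<m]) = concat (map (block q S j) [0..<m * q])"
    unfolding concat_map_group by (simp cong: map_cong)
  also have "\<dots> = S" using Suc by (simp add: mult.assoc)
  finally show ?case .
qed

text \<open>The energies \<open>\<Sum>\<^sub>i w\<^sub>j(i)\<^sup>2 / q\<^sup>j\<close> decrease from at most \<open>M q\<^sup>J\<close> to at least \<open>0\<close> as \<open>j\<close> runs from \<open>0\<close> to \<open>J\<close>,
  and the drop from \<open>j\<close> to \<open>j + 1\<close> is the total variance of \<open>w\<^sub>j\<close> within its groups.\<close>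

lemma small_variance_level:
  fixes w :: "nat \<Rightarrow> nat \<Rightarrow> real" and M q J :: nat
  assumes "q > 0" "J > 0"
    and w0: "\<And>i. 0 \<le> w 0 i" "\<And>i. w 0 i \<le> 1"
    and w_Suc: "\<And>j i. w (Suc j) i = (\<Sum>r = i * q..<i * q + q. w j r)"
  obtains j m where "j < J" "M * q ^ J = m * q ^ Suc j"
    "(\<Sum>p<m. \<Sum>r = p * q..<p * q + q. (w j r - w (Suc j) p / q)\<^sup>2 / q ^ j) \<le> M * q ^ J / J"
proof -
  define V where "V j = (\<Sum>p<M * q ^ (J - Suc j). \<Sum>r = p * q..<p * q + q.
    (w j r - w (Suc j) p / q)\<^sup>2 / q ^ j)" for j
  define E where "E j = (\<Sum>i<M * q ^ (J - j). (w j i)\<^sup>2 / q ^ j)" for j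
  have V: "V j = E j - E (Suc j)" if "j < J" for j
  proof -
    have group: "(\<Sum>r = p * q..<p * q + q. (w j r - w (Suc j) p / q)\<^sup>2 / q ^ j) =
      (\<Sum>r = p * q..<p * q + q. (w j r)\<^sup>2 / q ^ j) - (w (Suc j) p)\<^sup>2 / q ^ Suc j" for p
    proof -
      let ?a = "w (Suc j) p / q"
      have "(\<Sum>r = p * q..<p * q + q. (w j r - ?a)\<^sup>2) =
        (\<Sum>r = p * q..<p * q + q. (w j r)\<^sup>2 - 2 * ?a * w j r + ?a\<^sup>2)"
        by (rule sum.cong) (simp_all add: power2_diff algebra_simps)
      also have "\<dots> = (\<Sum>r = p * q..<p * q + q. (w j r)\<^sup>2) - 2 * ?a * w (Suc j) p + q * ?a\<^sup>2"
        by (simp only: sum.distrib sum_subtractf w_Suc sum_distrib_left) simp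
      also have "\<dots> = (\<Sum>r = p * q..<p * q + q. (w j r)\<^sup>2) - (w (Suc j) p)\<^sup>2 / q"
        using \<open>q > 0\<close> by (simp add: power2_eq_square field_simps)
      finally show ?thesis
        by (simp add: diff_divide_distrib flip: sum_divide_distrib)
    qed
    have "M * q ^ (J - j) = (M * q ^ (J - Suc j)) * q"
      using that by (simp add: Suc_diff_Suc flip: power_Suc2)
    then have "E j = (\<Sum>p<M * q ^ (J - Suc j). \<Sum>r = p * q..<p * q + q. (w j r)\<^sup>2 / q ^ j)"
      unfolding E_def by (simp only: sum.nat_group)
    then show ?thesis unfolding V_def E_def[of "Suc j"] group by (simp add: sum_subtractf)
  qed
  have "(\<Sum>j<J. V j) = E 0 - E J"
    using V sum_lessThan_telescope'[of E J] by simp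
  also have "\<dots> \<le> E 0" by (simp add: E_def sum_nonneg)
  also have "\<dots> \<le> (\<Sum>i<M * q ^ J. 1)"
    unfolding E_def diff_zero by (intro sum_mono) (simp add: w0 power_le_one)
  finally have total: "(\<Sum>j<J. V j) \<le> M * q ^ J" by simp
  have "\<exists>j<J. V j \<le> M * q ^ J / J"
  proof (rule ccontr)
    assume "\<not> (\<exists>j<J. V j \<le> M * q ^ J / J)"
    then have "(\<Sum>j<J. real (M * q ^ J) / J) < (\<Sum>j<J. V j)"
      using \<open>J > 0\<close> by (intro sum_strict_mono) (auto simp: not_le)
    with total \<open>J > 0\<close> show False by simp
  qed
  then obtain j where "j < J" "V j \<le> M * q ^ J / J" by blast
  moreover from \<open>j < J\<close> have "M * q ^ J = (M * q ^ (J - Suc j)) * q ^ Suc j"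
    by (simp only: mult.assoc flip: power_add) simp
  ultimately show thesis using that unfolding V_def by blast
qed

lemma twin_length_lower_multiple:
  assumes "q > 0" "length S = M * q ^ q\<^sup>2" "set S \<subseteq> {0, 1::nat}"
  shows "(1 - 4 / q) * length S \<le> 2 * real (twin_length S)"
proof -
  define w where "w j i = real (count_list (block q S j i) 1)" for j i
  have count_concat: "count_list (concat Xs) a = (\<Sum>X\<leftarrow>Xs. count_list X a)" for Xs and a :: nat
    by (induction Xs) auto
  have w0: "0 \<le> w 0 i" "w 0 i \<le> 1" for i by (simp_all add: w_def)
  have w_Suc: "w (Suc j) i = (\<Sum>r = i * q..<i * q + q. w j r)" for j i
    by (simp add: w_def count_concat comp_def interv_sum_list_conv_sum_set_nat)
  have "q\<^sup>2 > 0" using \<open>q > 0\<close> by simp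
  from small_variance_level[of q "q\<^sup>2" w M, OF \<open>q > 0\<close> this w0 w_Suc]
  obtain j m where len: "M * q ^ q\<^sup>2 = m * q ^ Suc j" and
    var: "(\<Sum>p<m. \<Sum>r = p * q..<p * q + q. (w j r - w (Suc j) p / q)\<^sup>2 / q ^ j)
      \<le> M * q ^ q\<^sup>2 / real (q\<^sup>2)"
    by blast
  let ?l = "real (q ^ j)"
  have l: "?l > 0" using \<open>q > 0\<close> by simp
  have parent: "(real q - 3) * ?l
      - q * (\<Sum>r = p * q..<p * q + q. (w j r - w (Suc j) p / q)\<^sup>2 / q ^ j)
      \<le> 2 * real (twin_length (block q S (Suc j) p))" if "p < m" for p
  proof -
    let ?\<mu> = "w (Suc j) p / q"
    let ?Bs = "map (block q S j) [p * q..<p * q + q]"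
    have bin: "set B \<subseteq> {0, 1} \<and> length B = q ^ j" if B: "B \<in> set ?Bs" for B
    proof -
      obtain r where r: "r \<in> {p * q..<p * q + q}" "B = block q S j r" using B by auto
      have "(r + 1) * q ^ j \<le> ((p + 1) * q) * q ^ j"
        using r by (intro mult_right_mono) auto
      also have "\<dots> \<le> (m * q) * q ^ j"
        using \<open>p < m\<close> by (intro mult_right_mono) auto
      also have "\<dots> = length S" using assms(2) len by (simp add: mult.assoc)
      finally show ?thesis using r set_block[OF assms(3)] by (simp add: length_block)
    qed
    have "?Bs \<noteq> []" using \<open>q > 0\<close> by simp
    from twin_length_blocks[OF this bin, of ?\<mu>]
    have "(real q - 2) * ?l - 2 * (\<Sum>B\<leftarrow>?Bs. \<bar>real (count_list B 1) - ?\<mu>\<bar>)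
      \<le> 2 * real (twin_length (block q S (Suc j) p))"
      by simp
    moreover have "(\<Sum>B\<leftarrow>?Bs. \<bar>real (count_list B 1) - ?\<mu>\<bar>) = (\<Sum>r = p * q..<p * q + q. \<bar>w j r - ?\<mu>\<bar>)"
      by (simp add: comp_def w_def interv_sum_list_conv_sum_set_nat)
    moreover have "2 * (\<Sum>r = p * q..<p * q + q. \<bar>w j r - ?\<mu>\<bar>)
      \<le> q * (\<Sum>r = p * q..<p * q + q. (w j r - ?\<mu>)\<^sup>2 / q ^ j) + ?l"
    proof -
      have amgm: "2 * \<bar>x\<bar> \<le> q * (x\<^sup>2 / q ^ j) + ?l / q" for x :: real
      proof -
        have "0 \<le> (q * \<bar>x\<bar> - ?l)\<^sup>2" by simp
        then have "2 * \<bar>x\<bar> * (q * ?l) \<le> q\<^sup>2 * x\<^sup>2 + ?l\<^sup>2"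
          by (simp add: power2_diff power_mult_distrib algebra_simps)
        then have "2 * \<bar>x\<bar> \<le> (q\<^sup>2 * x\<^sup>2 + ?l\<^sup>2) / (q * ?l)"
          using l \<open>q > 0\<close> by (simp add: pos_le_divide_eq)
        also have "\<dots> = q * (x\<^sup>2 / q ^ j) + ?l / q"
          using l \<open>q > 0\<close> by (simp add: field_simps power2_eq_square)
        finally show ?thesis .
      qed
      have "2 * (\<Sum>r = p * q..<p * q + q. \<bar>w j r - ?\<mu>\<bar>)
        \<le> (\<Sum>r = p * q..<p * q + q. q * ((w j r - ?\<mu>)\<^sup>2 / q ^ j) + ?l / q)"
        unfolding sum_distrib_left by (intro sum_mono amgm)
      also have "\<dots> = q * (\<Sum>r = p * q..<p * q + q. (w j r - ?\<mu>)\<^sup>2 / q ^ j) + ?l"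
        using \<open>q > 0\<close> by (simp add: sum.distrib sum_distrib_left)
      finally show ?thesis .
    qed
    ultimately show ?thesis by (simp add: algebra_simps)
  qed
  have "(1 - 4 / q) * length S = m * ((real q - 3) * ?l) - q * (real (length S) / real (q\<^sup>2))"
    using \<open>q > 0\<close> assms(2) len by (simp add: field_simps power2_eq_square)
  also have "\<dots> \<le> m * ((real q - 3) * ?l)
      - q * (\<Sum>p<m. \<Sum>r = p * q..<p * q + q. (w j r - w (Suc j) p / q)\<^sup>2 / q ^ j)"
    using var assms(2) by (intro diff_left_mono mult_left_mono) simp_all
  also have "\<dots> = (\<Sum>p<m. (real q - 3) * ?l
      - q * (\<Sum>r = p * q..<p * q + q. (w j r - w (Suc j) p / q)\<^sup>2 / q ^ j))"
    by (simp add: sum_subtractf sum_distrib_left)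
  also have "\<dots> \<le> (\<Sum>p<m. 2 * real (twin_length (block q S (Suc j) p)))"
    using parent by (intro sum_mono) simp
  also have "\<dots> = 2 * real (\<Sum>X\<leftarrow>map (block q S (Suc j)) [0..<m]. twin_length X)"
    by (simp add: comp_def interv_sum_list_conv_sum_set_nat sum_distrib_left lessThan_atLeast0
        del: block.simps)
  also have "\<dots> \<le> 2 * real (twin_length (concat (map (block q S (Suc j)) [0..<m])))"
    by (intro mult_left_mono of_nat_mono twin_length_concat) simp
  also have "\<dots> = 2 * real (twin_length S)"
    using concat_blocks[of S m q "Suc j"] assms(2) len by (simp only:)
  finally show ?thesis .
qed

lemma twin_length_lower:
  assumes "q > 0" "q ^ (q\<^sup>2 + 1) \<le> length S" "set S \<subseteq> {0, 1::nat}"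
  shows "(1 - 5 / q) * length S \<le> 2 * real (twin_length S)"
proof (cases "q \<le> 5")
  case True
  then have "1 - 5 / real q \<le> 0" using \<open>q > 0\<close> by simp
  then have "(1 - 5 / q) * length S \<le> 0" by (simp add: mult_le_0_iff)
  then show ?thesis by linarith
next
  case False
  let ?Q = "q ^ q\<^sup>2"
  let ?n = "length S"
  define T where "T = take (?n div ?Q * ?Q) S"
  have len: "length T = ?n div ?Q * ?Q" by (simp add: T_def)
  have "set T \<subseteq> {0, 1}" using assms(3) set_take_subset[of _ S] unfolding T_def by blast
  from twin_length_lower_multiple[OF assms(1) len this]
  have T: "(1 - 4 / q) * length T \<le> 2 * real (twin_length T)" .
  have "?n < length T + ?Q"
    using div_mult_mod_eq[of ?n ?Q] mod_less_divisor[of ?Q ?n] zero_less_power[OF \<open>q > 0\<close>, of "q\<^sup>2"]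
    unfolding len by linarith
  moreover have "real ?Q \<le> ?n / q"
  proof -
    have "real (?Q * q) \<le> ?n" using assms(2) by (simp only: of_nat_le_iff) (simp add: mult.commute)
    then show ?thesis using \<open>q > 0\<close> by (simp add: field_simps)
  qed
  ultimately have "real ?n - ?n / q \<le> length T" by linarith
  then have "(1 - 4 / q) * (real ?n - ?n / q) \<le> (1 - 4 / q) * length T"
    using False by (intro mult_left_mono) auto
  moreover have "(1 - 5 / q) * ?n \<le> (1 - 4 / q) * (real ?n - ?n / q)"
    using \<open>q > 0\<close> by (simp add: field_simps)
  moreover have "twin_length T \<le> twin_length S"
    using twin_length_append[of T "drop (?n div ?Q * ?Q) S"] by (simp add: T_def)
  ultimately show ?thesis using T by linarith
qed

theorem theorem1:
  shows "\<exists>C::real. C > 0 \<and> (\<forall>n::nat. ln (ln (real n)) > 0 \<longrightarrow>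
           (1 - C * (ln (real n) / ln (ln (real n))) powr (- 1 / 4)) * real n
             \<le> 2 * real (min_twin_length n {0, 1::nat})
         \<and> (n \<noteq> 3 \<longrightarrow>
           2 * real (min_twin_length n {0, 1::nat}) \<le> real n - ln (real n)))"
proof -
  define C :: real where "C = 10 + (exp 1 / ln (ln 3)) powr (1 / 4)"
  have "C \<ge> 10" by (simp add: C_def)
  have "(1 - C * (ln (real n) / ln (ln (real n))) powr (- 1 / 4)) * real n
             \<le> 2 * real (min_twin_length n {0, 1::nat})
         \<and> (n \<noteq> 3 \<longrightarrow>
           2 * real (min_twin_length n {0, 1::nat}) \<le> real n - ln (real n))"
    if n: "ln (ln (real n)) > 0" for n
  proof -
    have "n \<noteq> 0" using n by (intro notI) simp
    have L1: "ln (real n) > 1"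
    proof -
      have "ln (real n) > 0"
        using n \<open>n \<noteq> 0\<close> by (cases "n = 1") simp_all
      then show ?thesis using n by simp
    qed
    have "exp 1 < real n" using L1 \<open>n \<noteq> 0\<close> by (metis exp_less_cancel_iff exp_ln of_nat_0_less_iff gr0I)
    then have "n \<ge> 3" using exp_1_ge by linarith
    have upper: "2 * real (min_twin_length n {0, 1::nat}) \<le> real n - ln (real n)" if "n \<noteq> 3"
      using min_twin_length_upper[of n] \<open>n \<ge> 3\<close> that by linarith
    define L where "L = ln (real n)"
    define x where "x = (L / ln L) powr (1 / 4)"
    have lnL: "ln L > 0" "L > 1" using n L1 by (simp_all add: L_def)
    then have x: "x > 0" "x ^ 4 = L / ln L"
      by (simp_all add: x_def powr_power)
    have lower: "(1 - C * (1 / x)) * real n \<le> 2 * real (min_twin_length n {0, 1::nat})"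
    proof (cases "x \<le> C")
      case True
      then have "1 - C * (1 / x) \<le> 0" using x by (simp add: field_simps)
      then have "(1 - C * (1 / x)) * real n \<le> 0" by (simp add: mult_le_0_iff)
      then show ?thesis by linarith
    next
      case False
      have "ln L \<ge> 1"
      proof (rule ccontr)
        assume "\<not> ln L \<ge> 1"
        then have "L \<le> exp 1" using lnL by (smt (verit) exp_le_cancel_iff exp_ln)
        moreover have "ln 3 \<le> L" using \<open>n \<ge> 3\<close> by (simp add: L_def)
        moreover have "ln 3 > (1::real)"
          using e_less_272 ln_less_cancel_iff[of "exp 1" "3::real"] by simp
        ultimately have "L / ln L \<le> exp 1 / ln (ln 3)"
          using lnL by (intro frac_le) auto
        then have "x \<le> (exp 1 / ln (ln 3)) powr (1 / 4)"
          unfolding x_def using lnL by (intro powr_mono2) auto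
        then show False using False by (simp add: C_def)
      qed
      define q where "q = nat \<lfloor>x\<rfloor>"
      have "x \<ge> 10" using False \<open>C \<ge> 10\<close> by simp
      then have q: "real q \<le> x" "x < real q + 1" "q \<ge> 10"
        unfolding q_def by (simp_all add: le_nat_floor)
      have "(real (q\<^sup>2) + 1) * ln q \<le> L"
      proof -
        have "(real (q\<^sup>2) + 1) * ln q \<le> (2 * x\<^sup>2) * x"
        proof (rule mult_mono)
          have "real (q\<^sup>2) \<le> x\<^sup>2" using q by (simp add: power_mono)
          moreover have "1 \<le> x\<^sup>2" using \<open>x \<ge> 10\<close> by (simp add: one_le_power)
          ultimately show "real (q\<^sup>2) + 1 \<le> 2 * x\<^sup>2" by linarith
          show "ln (real q) \<le> x" using ln_le_minus_one[of "real q"] q by linarith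
        qed (use q in auto)
        also have "\<dots> = 2 * x ^ 3" by (simp add: power2_eq_square power3_eq_cube)
        also have "\<dots> \<le> x * x ^ 3" using \<open>x \<ge> 10\<close> by (intro mult_right_mono) auto
        also have "\<dots> = L / ln L" using x by (simp add: power_numeral_reduce)
        also have "\<dots> \<le> L" using \<open>ln L \<ge> 1\<close> lnL by (simp add: divide_le_eq mult_le_cancel_left1)
        finally show ?thesis .
      qed
      then have "ln (real (q ^ (q\<^sup>2 + 1))) \<le> ln (real n)"
        using q by (simp add: ln_realpow L_def algebra_simps ln_mult)
      then have "real (q ^ (q\<^sup>2 + 1)) \<le> real n"
        using q \<open>n \<noteq> 0\<close> by (subst (asm) ln_le_cancel_iff) auto
      then have qn: "q ^ (q\<^sup>2 + 1) \<le> n" by (simp only: of_nat_le_iff)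
      obtain S where S: "S \<in> words n {0, 1::nat}" "min_twin_length n {0, 1::nat} = twin_length S"
        using min_twin_length_attained[of "{0, 1::nat}" n] by auto
      have "(1 - 5 / q) * n \<le> 2 * real (min_twin_length n {0, 1::nat})"
        using twin_length_lower[of q S] q qn S by (simp add: words_def)
      moreover have "5 / real q \<le> C * (1 / x)"
      proof -
        have "5 / real q \<le> 10 / x" using q \<open>x \<ge> 10\<close> by (simp add: field_simps)
        also have "\<dots> \<le> C * (1 / x)" using \<open>C \<ge> 10\<close> x by (simp add: divide_right_mono)
        finally show ?thesis .
      qed
      then have "(1 - C * (1 / x)) * real n \<le> (1 - 5 / q) * n"
        by (intro mult_right_mono) auto
      ultimately show ?thesis by linarith
    qed
    have "(L / ln L) powr (- 1 / 4) = 1 / x"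
      by (simp add: x_def powr_minus_divide)
    then show ?thesis using lower upper by (simp add: L_def)
  qed
  then show ?thesis using \<open>C \<ge> 10\<close> by (intro exI[of _ C]) auto
qed

end
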